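(* Let $\mathbb{F}$ be a field of characteristic $0$. Consider the Jordan triple diproducts $(a,b,c)_1=\widehat{a}bc+cb\widehat{a}$ and $(a,b,c)_2=a\widehat{b}c+c\widehat{b}a$ in associative dialgebras over $\mathbb{F}$. Every polynomial identity of degree $\le 5$ satisfied by $(-,-,-)_1$ and $(-,-,-)_2$ in every associative dialgebra over $\mathbb{F}$ is a consequence of the following eight independent identities: \begin{align*} &(a,b,c)_2 \equiv (c,b,a)_2,\\ &( a, (b,c,d)_1, e )_1 \equiv ( a, (b,c,d)_2, e )_1,\\ &( a, b, (c,d,e)_1 )_1 \equiv ( a, b, (c,d,e)_2 )_1,\\ &( (a,b,c)_1, d, e )_2 \equiv ( (a,b,c)_2, d, e )_2,\\ &( (e,d,c)_1, b, a )_1 \equiv ( (e,b,a)_1, d, c )_1 - ( e, (d,a,b)_1, c )_1 + ( e, d, (c,b,a)_1 )_1,\\ &( (e,d,c)_2, b, a )_1 \equiv ( (e,b,a)_1, d, c )_2 - ( e, (d,a,b)_1, c )_2 + ( e, d, (c,b,a)_1 )_2,\\ &( (e,d,c)_1, b, a )_2 \equiv ( (e,b,a)_2, d, c )_1 - ( e, (b,a,d)_1, c )_2 + ( (c,b,a)_2, d, e )_1,\\ &( a, (b,c,d)_2, e )_2 \equiv ( (c,b,a)_1, d, e )_1 + ( (c,d,a)_1, b, e )_1 - ( c, (b,a,d)_1, e )_1. \end{align*}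
   Context: An associative dialgebra is a vector space with two bilinear operations $\dashv,\vdash$ satisfying $(a\dashv b)\vdash c=(a\vdash b)\vdash c$, $a\dashv(b\dashv c)=a\dashv(b\vdash c)$, $(a\dashv b)\dashv c=a\dashv(b\dashv c)$, $(a\vdash b)\vdash c=a\vdash(b\vdash c)$, $(a\vdash b)\dashv c=a\vdash(b\dashv c)$. Hat notation: $a_1\cdots a_{i-1}\widehat{a}_i a_{i+1}\cdots a_n=(a_1\vdash\cdots\vdash a_{i-1})\vdash a_i\dashv(a_{i+1}\dashv\cdots\dashv a_n)$. Thus $(a,b,c)_1=(a\dashv b)\dashv c+c\vdash(b\vdash a)$ and $(a,b,c)_2=(a\vdash b)\dashv c+(c\vdash b)\dashv a$. Polynomial identities are taken to be multilinear: an identity of degree $n$ is a linear combination, in the free nonassociative algebra over $\mathbb{F}$ with two trilinear operations, of monomials in which each of $n$ variables occurs exactly once; it is satisfied if it vanishes for all values of the variables in every associative dialgebra when the two operations are interpreted as $(-,-,-)_1$ and $(-,-,-)_2$. An identity is a consequence of a set of identities if it belongs to the T-ideal they generate in that free algebra (the smallest ideal containing them and closed under substitution of arbitrary elements for the variables). A set of identities is independent if none of them is a consequence of the others. *)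

theory Defs
  imports Complex_Main "HOL-Library.Poly_Mapping"
begin

section \<open>Associative dialgebras and the Jordan triple diproducts\<close>

locale associative_dialgebra = vector_space scale
  for scale :: "'f::field \<Rightarrow> 'v::ab_group_add \<Rightarrow> 'v" +
  fixes left :: "'v \<Rightarrow> 'v \<Rightarrow> 'v"  (infixl \<open>\<stileturn>\<close> 70)
    and right :: "'v \<Rightarrow> 'v \<Rightarrow> 'v"  (infixl \<open>\<turnstile>\<close> 70)
  assumes left_linear1: "Vector_Spaces.linear scale scale (\<lambda>a. a \<stileturn> b)"
    and left_linear2: "Vector_Spaces.linear scale scale (\<lambda>b. a \<stileturn> b)"
    and right_linear1: "Vector_Spaces.linear scale scale (\<lambda>a. a \<turnstile> b)"
    and right_linear2: "Vector_Spaces.linear scale scale (\<lambda>b. a \<turnstile> b)"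
    and right_bar: "(a \<stileturn> b) \<turnstile> c = (a \<turnstile> b) \<turnstile> c"
    and left_bar: "a \<stileturn> (b \<stileturn> c) = a \<stileturn> (b \<turnstile> c)"
    and left_assoc: "(a \<stileturn> b) \<stileturn> c = a \<stileturn> (b \<stileturn> c)"
    and right_assoc: "(a \<turnstile> b) \<turnstile> c = a \<turnstile> (b \<turnstile> c)"
    and inner_assoc: "(a \<turnstile> b) \<stileturn> c = a \<turnstile> (b \<stileturn> c)"
begin

definition diproduct1 :: "'v \<Rightarrow> 'v \<Rightarrow> 'v \<Rightarrow> 'v" where
  "diproduct1 a b c = (a \<stileturn> b) \<stileturn> c + c \<turnstile> (b \<turnstile> a)"

definition diproduct2 :: "'v \<Rightarrow> 'v \<Rightarrow> 'v \<Rightarrow> 'v" where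
  "diproduct2 a b c = (a \<turnstile> b) \<stileturn> c + (c \<turnstile> b) \<stileturn> a"

end


section \<open>The free nonassociative algebra with two trilinear operations\<close>

datatype tri_monomial =
    Var nat
  | Tri1 tri_monomial tri_monomial tri_monomial
  | Tri2 tri_monomial tri_monomial tri_monomial

primrec leaves :: "tri_monomial \<Rightarrow> nat list" where
  "leaves (Var i) = [i]"
| "leaves (Tri1 s t u) = leaves s @ leaves t @ leaves u"
| "leaves (Tri2 s t u) = leaves s @ leaves t @ leaves u"

type_synonym 'f tri_poly = "tri_monomial \<Rightarrow>\<^sub>0 'f"

definition tscale :: "'f::field \<Rightarrow> 'f tri_poly \<Rightarrow> 'f tri_poly" where
  "tscale c p = Poly_Mapping.map ((*) c) p"

lemma lookup_tscale:
  "Poly_Mapping.lookup (tscale c p) m = c * Poly_Mapping.lookup p m"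
  by (simp add: tscale_def Poly_Mapping.map.rep_eq when_def)

lemma vector_space_tscale: "vector_space (tscale :: 'f::field \<Rightarrow> _)"
  by unfold_locales
    (auto intro!: poly_mapping_eqI simp: lookup_tscale lookup_add algebra_simps)

definition var :: "nat \<Rightarrow> 'f::field tri_poly" where
  "var i = Poly_Mapping.single (Var i) 1"

definition trilinear_extension ::
    "(tri_monomial \<Rightarrow> tri_monomial \<Rightarrow> tri_monomial \<Rightarrow> tri_monomial)
     \<Rightarrow> 'f::field tri_poly \<Rightarrow> 'f tri_poly \<Rightarrow> 'f tri_poly \<Rightarrow> 'f tri_poly" where
  "trilinear_extension f p q r =
    (\<Sum>s\<in>Poly_Mapping.keys p. \<Sum>t\<in>Poly_Mapping.keys q. \<Sum>u\<in>Poly_Mapping.keys r.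
      Poly_Mapping.single (f s t u)
        (Poly_Mapping.lookup p s * Poly_Mapping.lookup q t * Poly_Mapping.lookup r u))"

definition op1 :: "'f::field tri_poly \<Rightarrow> 'f tri_poly \<Rightarrow> 'f tri_poly \<Rightarrow> 'f tri_poly" where
  "op1 = trilinear_extension Tri1"

definition op2 :: "'f::field tri_poly \<Rightarrow> 'f tri_poly \<Rightarrow> 'f tri_poly \<Rightarrow> 'f tri_poly" where
  "op2 = trilinear_extension Tri2"

primrec eval_monomial ::
    "('v \<Rightarrow> 'v \<Rightarrow> 'v \<Rightarrow> 'v) \<Rightarrow> ('v \<Rightarrow> 'v \<Rightarrow> 'v \<Rightarrow> 'v) \<Rightarrow> (nat \<Rightarrow> 'v) \<Rightarrow> tri_monomial \<Rightarrow> 'v" where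
  "eval_monomial f g x (Var i) = x i"
| "eval_monomial f g x (Tri1 s t u) =
     f (eval_monomial f g x s) (eval_monomial f g x t) (eval_monomial f g x u)"
| "eval_monomial f g x (Tri2 s t u) =
     g (eval_monomial f g x s) (eval_monomial f g x t) (eval_monomial f g x u)"

definition eval_tri_poly ::
    "('f::field \<Rightarrow> 'v::ab_group_add \<Rightarrow> 'v) \<Rightarrow> ('v \<Rightarrow> 'v \<Rightarrow> 'v \<Rightarrow> 'v) \<Rightarrow> ('v \<Rightarrow> 'v \<Rightarrow> 'v \<Rightarrow> 'v)
     \<Rightarrow> (nat \<Rightarrow> 'v) \<Rightarrow> 'f tri_poly \<Rightarrow> 'v" where
  "eval_tri_poly scale f g x p =
    (\<Sum>m\<in>Poly_Mapping.keys p. scale (Poly_Mapping.lookup p m) (eval_monomial f g x m))"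

definition substitute :: "(nat \<Rightarrow> 'f::field tri_poly) \<Rightarrow> 'f tri_poly \<Rightarrow> 'f tri_poly" where
  "substitute = eval_tri_poly tscale op1 op2"


section \<open>Polynomial identities, consequences, independence\<close>

text \<open>The zero polynomial is multilinear of every degree.\<close>

definition multilinear_of_degree :: "nat \<Rightarrow> 'f::field tri_poly \<Rightarrow> bool" where
  "multilinear_of_degree n p \<longleftrightarrow>
    (\<exists>V. finite V \<and> card V = n \<and>
      (\<forall>m\<in>Poly_Mapping.keys p. distinct (leaves m) \<and> set (leaves m) = V))"

text \<open>
  HOL does not quantify over types, so the property below ranges over all associative dialgebras
  with underlying type \<open>'v\<close>. No generality is lost for \<open>'v = nat \<Rightarrow>\<^sub>0 'f\<close>: the values of finitely
  many variables generate a subdialgebra of countable dimension, and every dialgebra of countable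
  dimension embeds into one of dimension \<open>\<aleph>\<^sub>0\<close> (add a direct summand with zero products), which is
  isomorphic to a dialgebra on the vector space \<open>nat \<Rightarrow>\<^sub>0 'f\<close>.
\<close>

definition satisfied_in_dialgebras :: "'v::ab_group_add itself \<Rightarrow> 'f::field tri_poly \<Rightarrow> bool" where
  "satisfied_in_dialgebras _ p \<longleftrightarrow>
    (\<forall>(scale :: 'f \<Rightarrow> 'v \<Rightarrow> 'v) left right x. associative_dialgebra scale left right \<longrightarrow>
      eval_tri_poly scale
        (associative_dialgebra.diproduct1 left right)
        (associative_dialgebra.diproduct2 left right) x p = 0)"

definition T_ideal :: "'f::field tri_poly set \<Rightarrow> bool" where
  "T_ideal I \<longleftrightarrow>
    module.subspace tscale I \<and>
    (\<forall>p\<in>I. \<forall>q r.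
      op1 p q r \<in> I \<and> op1 q p r \<in> I \<and> op1 q r p \<in> I \<and>
      op2 p q r \<in> I \<and> op2 q p r \<in> I \<and> op2 q r p \<in> I) \<and>
    (\<forall>p\<in>I. \<forall>\<sigma>. substitute \<sigma> p \<in> I)"

definition consequence :: "'f::field tri_poly set \<Rightarrow> 'f tri_poly \<Rightarrow> bool" where
  "consequence S p \<longleftrightarrow> p \<in> T_ideal hull S"

definition independent_identities :: "'f::field tri_poly set \<Rightarrow> bool" where
  "independent_identities S \<longleftrightarrow> (\<forall>p\<in>S. \<not> consequence (S - {p}) p)"

text \<open>Each identity \<open>l \<equiv> r\<close> is represented by the polynomial \<open>l - r\<close>.\<close>

definition jordan_triple_identities :: "'f::field tri_poly set" where
  "jordan_triple_identities =
    (let a = var 0; b = var 1; c = var 2; d = var 3; e = var 4 in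
     { op2 a b c - op2 c b a,
       op1 a (op1 b c d) e - op1 a (op2 b c d) e,
       op1 a b (op1 c d e) - op1 a b (op2 c d e),
       op2 (op1 a b c) d e - op2 (op2 a b c) d e,
       op1 (op1 e d c) b a
         - (op1 (op1 e b a) d c - op1 e (op1 d a b) c + op1 e d (op1 c b a)),
       op1 (op2 e d c) b a
         - (op2 (op1 e b a) d c - op2 e (op1 d a b) c + op2 e d (op1 c b a)),
       op2 (op1 e d c) b a
         - (op1 (op2 e b a) d c - op2 e (op1 b a d) c + op1 (op2 c b a) d e),
       op2 a (op2 b c d) e
         - (op1 (op1 c b a) d e + op1 (op1 c d a) b e - op1 c (op1 b a d) e) })"

end

theory Submission
  imports Defs "HOL-Library.Product_Plus" "HOL-Library.Countable"
begin

text \<open>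
  \<^emph>\<open>Soundness.\<close> In an associative dialgebra every product of several factors equals a word with one
  distinguished (hatted) letter, so the identities are checked by expanding both sides into such
  words.

  \<^emph>\<open>Independence.\<close> Each identity already fails in an algebra generated by one degree-one coordinate,
  where a product in degree five depends only on the shape of the bracketing. In such a graded
  algebra the identities become linear conditions on twelve structure constants, and for each of
  the eight there is a choice of constants that violates it and meets the other
  seven. The identities of an algebra form a T-ideal, so the violated one is not a consequence of
  the rest; taken over all eight, this also shows that they are pairwise distinct.

  \<^emph>\<open>Completeness.\<close> Monomials have an odd number of leaves, so the degrees one, three and five
  matter, and five is the interesting one. Let a pointed word be a word with a distinguished
  letter, and identify a pointed word with its reversal. Up to the first four identities, a
  monomial of degree five evaluates in the free dialgebra to the sum of exactly two pointed words
  (each together with its reversal). View pointed words as vertices and monomials as edges. The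
  resulting graph is a disjoint union of copies of the complete bipartite graph \<open>K\<close> on three plus three
  vertices: one kind of copy carries the words with the distinguished letter in an odd position,
  the other kind those with the distinguished letter in an even position. A linear combination of
  monomials vanishes in the free dialgebra iff the weights around every vertex sum to zero. Since
  \<open>K\<close> is bipartite, these are the combinations of alternating sums along cycles of length
  four, and the last four identities are exactly such alternating sums, enough of them to generate
  all.

  Dually, let \<open>\<phi>\<close> be a linear functional on the free algebra that vanishes on a T-ideal containing
  the identities. Then \<open>\<phi>\<close>, as a function on the edges, has alternating sum zero on every
  four-cycle, so it is the sum of a potential over the two end points of each edge. Averaging over
  \<open>K\<close> gives the potential explicitly: a third of the sum over the star of the vertex, minus an
  eighteenth of the sum over all nine edges. Hence \<open>\<phi>\<close> factors through evaluation in the dialgebra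
  of pointed words, and it kills every polynomial of degree at most five that vanishes
  there. As a subspace is the intersection of the kernels of the functionals that
  vanish on it, such a polynomial lies in the T-ideal.
\<close>

section \<open>Linear extension and evaluation\<close>

definition linear_extension ::
    "('f::field \<Rightarrow> 'v::ab_group_add \<Rightarrow> 'v) \<Rightarrow> ('i \<Rightarrow> 'v) \<Rightarrow> ('i \<Rightarrow>\<^sub>0 'f) \<Rightarrow> 'v" where
  "linear_extension scale h p =
    (\<Sum>m\<in>Poly_Mapping.keys p. scale (Poly_Mapping.lookup p m) (h m))"

text \<open>
  The same operation as \<^const>\<open>tscale\<close>, for an arbitrary index type: it serves the free algebra and
  the dialgebra of words alike.
\<close>

definition coeff_scale :: "'f::field \<Rightarrow> ('i \<Rightarrow>\<^sub>0 'f) \<Rightarrow> ('i \<Rightarrow>\<^sub>0 'f)" where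
  "coeff_scale c p = Poly_Mapping.map ((*) c) p"

lemma lookup_coeff_scale [simp]:
  "Poly_Mapping.lookup (coeff_scale c p) m = c * Poly_Mapping.lookup p m"
  by (simp add: coeff_scale_def Poly_Mapping.map.rep_eq when_def)

lemma coeff_scale_single [simp]:
  "coeff_scale c (Poly_Mapping.single m d) = Poly_Mapping.single m (c * d)"
  by (rule poly_mapping_eqI) (simp add: lookup_single when_def)

lemma vector_space_coeff_scale: "vector_space (coeff_scale :: 'f::field \<Rightarrow> _)"
  by unfold_locales (auto intro!: poly_mapping_eqI simp: lookup_add algebra_simps)

lemma tscale_eq_coeff_scale: "tscale = coeff_scale"
  by (intro ext) (simp add: tscale_def coeff_scale_def)

lemma eval_tri_poly_eq_linear_extension:
  "eval_tri_poly scale f g x = linear_extension scale (eval_monomial f g x)"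
  by (intro ext) (simp add: eval_tri_poly_def linear_extension_def)

context vector_space
begin

lemma linear_extension_superset:
  assumes "finite A" "Poly_Mapping.keys p \<subseteq> A"
  shows "linear_extension scale h p = (\<Sum>m\<in>A. scale (Poly_Mapping.lookup p m) (h m))"
  unfolding linear_extension_def
  using assms by (intro sum.mono_neutral_left) (auto simp: in_keys_iff)

lemma linear_extension_add:
  "linear_extension scale h (p + q) = linear_extension scale h p + linear_extension scale h q"
proof -
  let ?A = "Poly_Mapping.keys p \<union> Poly_Mapping.keys q"
  have "Poly_Mapping.keys (p + q) \<subseteq> ?A"
    by (rule Poly_Mapping.keys_add)
  then show ?thesis
    by (simp add: linear_extension_superset[of ?A] lookup_add scale_left_distrib sum.distrib)
qed

lemma linear_extension_coeff_scale:
  "linear_extension scale h (coeff_scale c p) = scale c (linear_extension scale h p)"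
proof -
  have "Poly_Mapping.keys (coeff_scale c p) \<subseteq> Poly_Mapping.keys p"
    by (auto simp: in_keys_iff)
  then show ?thesis
    by (simp add: linear_extension_superset[of "Poly_Mapping.keys p"] scale_sum_right)
qed

lemma linear_linear_extension:
  "Vector_Spaces.linear coeff_scale scale (linear_extension scale h)"
  by (simp add: Vector_Spaces.linear_iff vector_space_axioms vector_space_coeff_scale
      linear_extension_add linear_extension_coeff_scale)

lemma linear_extension_single [simp]:
  "linear_extension scale h (Poly_Mapping.single m c) = scale c (h m)"
  by (simp add: linear_extension_superset[of "{m}"])

lemma linear_extension_0 [simp]: "linear_extension scale h 0 = 0"
  by (simp add: linear_extension_def)

lemma linear_extension_diff:
  "linear_extension scale h (p - q) = linear_extension scale h p - linear_extension scale h q"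
  by (metis linear_extension_add add_diff_cancel_right' diff_add_cancel)

lemma linear_extension_sum:
  "linear_extension scale h (\<Sum>i\<in>A. p i) = (\<Sum>i\<in>A. linear_extension scale h (p i))"
  by (induction A rule: infinite_finite_induct) (simp_all add: linear_extension_add)

lemma linear_extension_of_add:
  "linear_extension scale (\<lambda>m. h m + h' m) p = linear_extension scale h p + linear_extension scale h' p"
  by (simp add: linear_extension_def scale_right_distrib sum.distrib)

lemma linear_extension_of_scale:
  "linear_extension scale (\<lambda>m. scale c (h m)) p = scale c (linear_extension scale h p)"
  by (simp add: linear_extension_def scale_sum_right mult.commute)

end

lemma poly_mapping_induct_single_add [case_names single add]:
  fixes p :: "'i \<Rightarrow>\<^sub>0 'f::field"
  assumes single: "\<And>m c. P (Poly_Mapping.single m c)" and add: "\<And>p q. P p \<Longrightarrow> P q \<Longrightarrow> P (p + q)"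
  shows "P p"
proof -
  have "P (\<Sum>m\<in>A. Poly_Mapping.single m (Poly_Mapping.lookup p m))" for A
  proof (induction A rule: infinite_finite_induct)
    case (insert m A)
    then show ?case by (simp add: single add)
  qed (use single[of undefined 0] in simp_all)
  moreover have "(\<Sum>m\<in>Poly_Mapping.keys p. Poly_Mapping.single m (Poly_Mapping.lookup p m)) = p"
    by (rule poly_mapping_eqI)
      (auto simp: lookup_sum lookup_single when_def in_keys_iff)
  ultimately show ?thesis by metis
qed

text \<open>
  Trilinearity of the products is what makes evaluation commute with \<^const>\<open>op1\<close> and \<^const>\<open>op2\<close>.
\<close>

definition trilinear ::
    "('f::field \<Rightarrow> 'v::ab_group_add \<Rightarrow> 'v) \<Rightarrow> ('v \<Rightarrow> 'v \<Rightarrow> 'v \<Rightarrow> 'v) \<Rightarrow> bool" where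
  "trilinear scale f \<longleftrightarrow>
    (\<forall>b c. Vector_Spaces.linear scale scale (\<lambda>a. f a b c)) \<and>
    (\<forall>a c. Vector_Spaces.linear scale scale (\<lambda>b. f a b c)) \<and>
    (\<forall>a b. Vector_Spaces.linear scale scale (\<lambda>c. f a b c))"

lemma (in vector_space) trilinear_sum:
  assumes "trilinear scale f"
  shows "f (\<Sum>i\<in>A. scale (\<alpha> i) (x i)) (\<Sum>j\<in>B. scale (\<beta> j) (y j)) (\<Sum>k\<in>C. scale (\<gamma> k) (z k)) =
    (\<Sum>i\<in>A. \<Sum>j\<in>B. \<Sum>k\<in>C. scale (\<alpha> i * \<beta> j * \<gamma> k) (f (x i) (y j) (z k)))"
proof -
  interpret l1: Vector_Spaces.linear scale scale "\<lambda>a. f a b c" for b c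
    using assms by (simp add: trilinear_def)
  interpret l2: Vector_Spaces.linear scale scale "\<lambda>b. f a b c" for a c
    using assms by (simp add: trilinear_def)
  interpret l3: Vector_Spaces.linear scale scale "\<lambda>c. f a b c" for a b
    using assms by (simp add: trilinear_def)
  let ?y = "\<Sum>j\<in>B. scale (\<beta> j) (y j)" and ?z = "\<Sum>k\<in>C. scale (\<gamma> k) (z k)"
  have "f (\<Sum>i\<in>A. scale (\<alpha> i) (x i)) ?y ?z = (\<Sum>i\<in>A. scale (\<alpha> i) (f (x i) ?y ?z))"
    by (simp only: l1.sum l1.scale)
  also have "\<dots> = (\<Sum>i\<in>A. \<Sum>j\<in>B. scale (\<alpha> i * \<beta> j) (f (x i) (y j) ?z))"
    by (simp only: l2.sum l2.scale scale_sum_right scale_scale)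
  also have "\<dots> = (\<Sum>i\<in>A. \<Sum>j\<in>B. \<Sum>k\<in>C. scale (\<alpha> i * \<beta> j * \<gamma> k) (f (x i) (y j) (z k)))"
    by (simp only: l3.sum l3.scale scale_sum_right scale_scale)
  finally show ?thesis .
qed

lemma (in vector_space) trilinear_diff:
  assumes "trilinear scale f"
  shows "f (a - a') b c = f a b c - f a' b c"
    and "f a (b - b') c = f a b c - f a b' c"
    and "f a b (c - c') = f a b c - f a b c'"
proof -
  interpret l1: Vector_Spaces.linear scale scale "\<lambda>a. f a b c" for b c
    using assms by (simp add: trilinear_def)
  interpret l2: Vector_Spaces.linear scale scale "\<lambda>b. f a b c" for a c
    using assms by (simp add: trilinear_def)
  interpret l3: Vector_Spaces.linear scale scale "\<lambda>c. f a b c" for a b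
    using assms by (simp add: trilinear_def)
  show "f (a - a') b c = f a b c - f a' b c" "f a (b - b') c = f a b c - f a b' c"
    "f a b (c - c') = f a b c - f a b c'"
    by (fact l1.diff l2.diff l3.diff)+
qed

lemma (in vector_space) trilinear_zero:
  assumes "trilinear scale f"
  shows "f 0 b c = 0" "f a 0 c = 0" "f a b 0 = 0"
  using trilinear_diff(1)[OF assms, of 0 0 b c] trilinear_diff(2)[OF assms, of a 0 0 c]
    trilinear_diff(3)[OF assms, of a b 0 0] by simp_all

lemma (in vector_space) linear_extension_trilinear_extension:
  assumes "trilinear scale f" and "\<And>s t u. h (F s t u) = f (h s) (h t) (h u)"
  shows "linear_extension scale h (trilinear_extension F p q r) =
    f (linear_extension scale h p) (linear_extension scale h q) (linear_extension scale h r)"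
  unfolding trilinear_extension_def linear_extension_sum linear_extension_single
  by (simp add: linear_extension_def trilinear_sum[OF assms(1)] assms(2))

text \<open>
  An iterated linear extension is visibly linear in each argument, unlike a sum over the supports
  of all three arguments.
\<close>

lemma trilinear_extension_eq:
  fixes p q r :: "'f::field tri_poly"
  shows "trilinear_extension F p q r =
    linear_extension tscale (\<lambda>s. linear_extension tscale (\<lambda>t. linear_extension tscale
      (\<lambda>u. Poly_Mapping.single (F s t u) 1) r) q) p"
proof -
  interpret vector_space "coeff_scale :: 'f \<Rightarrow> 'f tri_poly \<Rightarrow> 'f tri_poly"
    by (rule vector_space_coeff_scale)
  show ?thesis
    unfolding tscale_eq_coeff_scale
    by (simp add: linear_extension_def trilinear_extension_def scale_sum_right mult.assoc)
qed

lemma trilinear_trilinear_extension: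
  "trilinear tscale (trilinear_extension F :: 'f::field tri_poly \<Rightarrow> _)"
proof -
  interpret vector_space "coeff_scale :: 'f \<Rightarrow> 'f tri_poly \<Rightarrow> 'f tri_poly"
    by (rule vector_space_coeff_scale)
  show ?thesis
    unfolding trilinear_def trilinear_extension_eq[abs_def] tscale_eq_coeff_scale
    by (auto simp: Vector_Spaces.linear_iff vector_space_axioms linear_extension_add
        linear_extension_coeff_scale linear_extension_of_add linear_extension_of_scale)
qed

locale trilinear_algebra = vector_space scale
  for scale :: "'f::field \<Rightarrow> 'v::ab_group_add \<Rightarrow> 'v" +
  fixes f g :: "'v \<Rightarrow> 'v \<Rightarrow> 'v \<Rightarrow> 'v"
  assumes trilinear_f: "trilinear scale f" and trilinear_g: "trilinear scale g"
begin

abbreviation "value_at \<equiv> eval_tri_poly scale f g"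

lemma value_at_var [simp]: "value_at x (var i) = x i"
  by (simp add: eval_tri_poly_eq_linear_extension var_def)

lemma value_at_op1 [simp]:
  "value_at x (op1 p q r) = f (value_at x p) (value_at x q) (value_at x r)"
  unfolding eval_tri_poly_eq_linear_extension op1_def
  by (rule linear_extension_trilinear_extension[OF trilinear_f]) simp

lemma value_at_op2 [simp]:
  "value_at x (op2 p q r) = g (value_at x p) (value_at x q) (value_at x r)"
  unfolding eval_tri_poly_eq_linear_extension op2_def
  by (rule linear_extension_trilinear_extension[OF trilinear_g]) simp

lemma value_at_0 [simp]: "value_at x 0 = 0"
  by (simp add: eval_tri_poly_eq_linear_extension)

lemma value_at_add [simp]: "value_at x (p + q) = value_at x p + value_at x q"
  by (simp add: eval_tri_poly_eq_linear_extension linear_extension_add)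

lemma value_at_diff [simp]: "value_at x (p - q) = value_at x p - value_at x q"
  by (simp add: eval_tri_poly_eq_linear_extension linear_extension_diff)

lemma value_at_tscale [simp]: "value_at x (tscale c p) = scale c (value_at x p)"
  by (simp add: eval_tri_poly_eq_linear_extension linear_extension_coeff_scale tscale_eq_coeff_scale)

lemma value_at_sum: "value_at x (\<Sum>i\<in>A. p i) = (\<Sum>i\<in>A. value_at x (p i))"
  by (simp add: eval_tri_poly_eq_linear_extension linear_extension_sum)

text \<open>
  The free algebra is itself a model in which substitution is evaluation, so this is the
  composition of two evaluations.
\<close>

lemma value_at_substitute:
  "value_at x (substitute \<sigma> p) = value_at (\<lambda>i. value_at x (\<sigma> i)) p"
proof -
  have "value_at x (eval_monomial op1 op2 \<sigma> m) = eval_monomial f g (\<lambda>i. value_at x (\<sigma> i)) m" for m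
    by (induction m) simp_all
  then show ?thesis
    by (simp add: substitute_def eval_tri_poly_def[of tscale] value_at_sum)
      (simp add: eval_tri_poly_def)
qed

text \<open>
  This turns every algebra into an obstruction: what fails in it is no consequence of what holds
  in it.
\<close>

lemma T_ideal_identities_of_algebra: "T_ideal {p. \<forall>x. value_at x p = 0}"
proof -
  interpret T: vector_space "tscale :: 'f \<Rightarrow> _"
    by (rule vector_space_tscale)
  show ?thesis
    unfolding T_ideal_def T.subspace_def
    by (simp add: trilinear_zero[OF trilinear_f] trilinear_zero[OF trilinear_g] value_at_substitute)
qed

end

interpretation free: trilinear_algebra "tscale :: 'f::field \<Rightarrow> _" op1 op2
  by (intro trilinear_algebra.intro trilinear_algebra_axioms.intro vector_space_tscale)
    (simp_all add: op1_def op2_def trilinear_trilinear_extension)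

section \<open>The identities as expressions in an arbitrary pair of triple products\<close>

text \<open>
  Keeping the products as parameters lets one list serve three purposes: the identities
  themselves, their values in a model, and their instances at arbitrary elements of the free
  algebra.
\<close>

definition identity_expressions ::
    "('v \<Rightarrow> 'v \<Rightarrow> 'v \<Rightarrow> 'v) \<Rightarrow> ('v \<Rightarrow> 'v \<Rightarrow> 'v \<Rightarrow> 'v) \<Rightarrow> 'v \<Rightarrow> 'v \<Rightarrow> 'v \<Rightarrow> 'v \<Rightarrow> 'v \<Rightarrow> 'v::ab_group_add list" where
  "identity_expressions f g a b c d e =
    [g a b c - g c b a,
     f a (f b c d) e - f a (g b c d) e,
     f a b (f c d e) - f a b (g c d e),
     g (f a b c) d e - g (g a b c) d e,
     f (f e d c) b a - (f (f e b a) d c - f e (f d a b) c + f e d (f c b a)),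
     f (g e d c) b a - (g (f e b a) d c - g e (f d a b) c + g e d (f c b a)),
     g (f e d c) b a - (f (g e b a) d c - g e (f b a d) c + f (g c b a) d e),
     g a (g b c d) e - (f (f c b a) d e + f (f c d a) b e - f c (f b a d) e)]"

definition identity_list :: "'f::field tri_poly list" where
  "identity_list = identity_expressions op1 op2 (var 0) (var 1) (var 2) (var 3) (var 4)"

lemma jordan_triple_identities_eq_set: "jordan_triple_identities = set identity_list"
  by (simp add: jordan_triple_identities_def identity_list_def identity_expressions_def Let_def)

lemma length_identity_list [simp]: "length identity_list = 8"
  by (simp add: identity_list_def identity_expressions_def)

lemma (in trilinear_algebra) map_value_at_identity_list:
  "map (value_at x) identity_list = identity_expressions f g (x 0) (x 1) (x 2) (x 3) (x 4)"
  by (simp add: identity_list_def identity_expressions_def)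

section \<open>The identities hold in every associative dialgebra\<close>

context associative_dialgebra
begin

sublocale left1: Vector_Spaces.linear scale scale "\<lambda>a. a \<stileturn> b" for b by (rule left_linear1)
sublocale left2: Vector_Spaces.linear scale scale "\<lambda>b. a \<stileturn> b" for a by (rule left_linear2)
sublocale right1: Vector_Spaces.linear scale scale "\<lambda>a. a \<turnstile> b" for b by (rule right_linear1)
sublocale right2: Vector_Spaces.linear scale scale "\<lambda>b. a \<turnstile> b" for a by (rule right_linear2)

lemmas product_linear =
  left1.add left2.add right1.add right2.add left1.scale left2.scale right1.scale right2.scale

lemma trilinear_algebra_diproducts: "trilinear_algebra scale diproduct1 diproduct2"
  by unfold_locales
    (simp_all add: trilinear_def Vector_Spaces.linear_iff vector_space_axioms
      diproduct1_def diproduct2_def product_linear scale_right_distrib)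

text \<open>
  Rewriting from left to right moves every product out of the left argument of \<open>\<turnstile>\<close> and out of
  the right argument of \<open>\<stileturn>\<close>; what remains is
  \<open>x\<^sub>1 \<turnstile> (x\<^sub>2 \<turnstile> \<dots> ((y \<stileturn> z\<^sub>1) \<stileturn> z\<^sub>2) \<dots>)\<close> with the hatted factor \<open>y\<close>.
\<close>

lemma hat_normal_form:
  "(a \<stileturn> b) \<turnstile> c = a \<turnstile> (b \<turnstile> c)"
  "(a \<turnstile> b) \<turnstile> c = a \<turnstile> (b \<turnstile> c)"
  "a \<stileturn> (b \<stileturn> c) = (a \<stileturn> b) \<stileturn> c"
  "a \<stileturn> (b \<turnstile> c) = (a \<stileturn> b) \<stileturn> c"
  "(a \<turnstile> b) \<stileturn> c = a \<turnstile> (b \<stileturn> c)"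
  by (simp_all only: right_bar right_assoc left_assoc left_bar[symmetric] inner_assoc)

lemma identity_expressions_diproducts:
  "set (identity_expressions diproduct1 diproduct2 a b c d e) \<subseteq> {0}"
  by (simp add: identity_expressions_def diproduct1_def diproduct2_def product_linear
      hat_normal_form add_ac)

end

lemma identities_satisfied_in_dialgebras:
  assumes "p \<in> jordan_triple_identities"
  shows "satisfied_in_dialgebras TYPE('v::ab_group_add) (p :: 'f::field tri_poly)"
  unfolding satisfied_in_dialgebras_def
proof (intro allI impI)
  fix scale :: "'f \<Rightarrow> 'v \<Rightarrow> 'v" and left right x
  assume "associative_dialgebra scale left right"
  then interpret associative_dialgebra scale left right .
  interpret J: trilinear_algebra scale diproduct1 diproduct2
    by (rule trilinear_algebra_diproducts)
  have "J.value_at x p \<in> set (map (J.value_at x) identity_list)"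
    using assms by (simp add: jordan_triple_identities_eq_set)
  then show "J.value_at x p = 0"
    using identity_expressions_diproducts[of "x 0" "x 1" "x 2" "x 3" "x 4"]
    unfolding J.map_value_at_identity_list by blast
qed

section \<open>Independence\<close>

definition quadruple_scale :: "'f::field \<Rightarrow> 'f \<times> 'f \<times> 'f \<times> 'f \<Rightarrow> 'f \<times> 'f \<times> 'f \<times> 'f" where
  "quadruple_scale c = (\<lambda>(x, u, v, z). (c * x, c * u, c * v, c * z))"

text \<open>
  A nilpotent algebra with coordinates \<open>(x, u, v, z)\<close> of degrees 1, 3, 3 and 5: \<open>u\<close> collects the
  triple products formed with the first operation, \<open>v\<close> those formed with the second, and \<open>z\<close> all
  products of degree five. The constant \<open>\<alpha> k l j\<close> belongs to outer operation \<open>k\<close> and inner operation \<open>l\<close>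
  with the inner product in argument position \<open>j \<in> {0, 1, 2}\<close>.
\<close>

definition graded_product ::
    "(nat \<Rightarrow> nat \<Rightarrow> nat \<Rightarrow> 'f::field) \<Rightarrow> nat \<Rightarrow>
     'f \<times> 'f \<times> 'f \<times> 'f \<Rightarrow> 'f \<times> 'f \<times> 'f \<times> 'f \<Rightarrow> 'f \<times> 'f \<times> 'f \<times> 'f \<Rightarrow> 'f \<times> 'f \<times> 'f \<times> 'f" where
  "graded_product \<alpha> k = (\<lambda>(x, u, v, z) (x', u', v', z') (x'', u'', v'', z'').
    (0, of_bool (k = 1) * (x * x' * x''), of_bool (k = 2) * (x * x' * x''),
     (\<alpha> k 1 0 * u + \<alpha> k 2 0 * v) * x' * x'' +
     (\<alpha> k 1 1 * u' + \<alpha> k 2 1 * v') * x * x'' +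
     (\<alpha> k 1 2 * u'' + \<alpha> k 2 2 * v'') * x * x'))"

lemma trilinear_algebra_graded_product:
  "trilinear_algebra quadruple_scale (graded_product \<alpha> 1) (graded_product \<alpha> 2)"
proof -
  interpret vector_space "quadruple_scale :: 'a \<Rightarrow> _"
    by unfold_locales (auto simp: quadruple_scale_def algebra_simps split: prod.splits)
  have "trilinear quadruple_scale (graded_product \<alpha> k)" for k
    unfolding trilinear_def Vector_Spaces.linear_iff
    by (auto simp: vector_space_axioms quadruple_scale_def graded_product_def algebra_simps
        split: prod.splits)
  then show ?thesis
    by unfold_locales
qed

text \<open>
  The identities of degree five evaluated on one generator; in the first condition the symmetry of
  the second operation relates the two outer positions of the inner product.
\<close>

definition graded_conditions :: "(nat \<Rightarrow> nat \<Rightarrow> nat \<Rightarrow> 'f::field) \<Rightarrow> bool list" where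
  "graded_conditions \<alpha> =
    [\<alpha> 2 1 0 = \<alpha> 2 1 2 \<and> \<alpha> 2 2 0 = \<alpha> 2 2 2,
     \<alpha> 1 1 1 = \<alpha> 1 2 1,
     \<alpha> 1 1 2 = \<alpha> 1 2 2,
     \<alpha> 2 1 0 = \<alpha> 2 2 0,
     \<alpha> 1 1 1 = \<alpha> 1 1 2,
     \<alpha> 1 2 0 = \<alpha> 2 1 0 - \<alpha> 2 1 1 + \<alpha> 2 1 2,
     \<alpha> 2 1 0 = 2 * \<alpha> 1 2 0 - \<alpha> 2 1 1,
     \<alpha> 2 2 1 = 2 * \<alpha> 1 1 0 - \<alpha> 1 1 1]"

text \<open>
  In degree five the coordinates of degree one enter only through their product, because each
  variable occurs once; this leaves a single scalar factor per identity.
\<close>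

lemma identity_expressions_graded_product:
  "identity_expressions (graded_product \<alpha> 1) (graded_product \<alpha> 2)
     (a, a1, a2, a3) (b, b1, b2, b3) (c, c1, c2, c3) (d, d1, d2, d3) (e, e1, e2, e3) =
   (0, 0, 0, (\<alpha> 2 1 0 - \<alpha> 2 1 2) * b * (a1 * c - c1 * a) + (\<alpha> 2 2 0 - \<alpha> 2 2 2) * b * (a2 * c - c2 * a)) #
   map (\<lambda>t. (0, 0, 0, t * (a * b * c * d * e)))
    [\<alpha> 1 1 1 - \<alpha> 1 2 1,
     \<alpha> 1 1 2 - \<alpha> 1 2 2,
     \<alpha> 2 1 0 - \<alpha> 2 2 0,
     \<alpha> 1 1 1 - \<alpha> 1 1 2,
     \<alpha> 1 2 0 - (\<alpha> 2 1 0 - \<alpha> 2 1 1 + \<alpha> 2 1 2),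
     \<alpha> 2 1 0 - (2 * \<alpha> 1 2 0 - \<alpha> 2 1 1),
     \<alpha> 2 2 1 - (2 * \<alpha> 1 1 0 - \<alpha> 1 1 1)]"
  by (simp add: identity_expressions_def graded_product_def algebra_simps)

lemma less_8_cases: "i < 8 \<Longrightarrow> i = 0 \<or> i = 1 \<or> i = 2 \<or> i = 3 \<or> i = 4 \<or> i = 5 \<or> i = 6 \<or> i = (7::nat)"
  by linarith

lemma graded_identity_iff:
  fixes \<alpha> :: "nat \<Rightarrow> nat \<Rightarrow> nat \<Rightarrow> 'f::field"
  assumes "i < 8"
  shows "(\<forall>x. eval_tri_poly quadruple_scale (graded_product \<alpha> 1) (graded_product \<alpha> 2) x (identity_list ! i) = 0)
    \<longleftrightarrow> graded_conditions \<alpha> ! i" (is "(\<forall>x. ?E x = 0) \<longleftrightarrow> _")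
proof -
  interpret M: trilinear_algebra quadruple_scale "graded_product \<alpha> 1" "graded_product \<alpha> 2"
    by (rule trilinear_algebra_graded_product)
  have value_eq: "?E x = identity_expressions (graded_product \<alpha> 1) (graded_product \<alpha> 2)
      (x 0) (x 1) (x 2) (x 3) (x 4) ! i" for x
    using assms by (simp only: M.map_value_at_identity_list[symmetric] nth_map length_identity_list)
  show ?thesis
  proof
    assume "graded_conditions \<alpha> ! i"
    then have "?E x = 0" for x
      using less_8_cases[OF assms] unfolding value_eq
      by (cases "x 0"; cases "x 1"; cases "x 2"; cases "x 3"; cases "x 4";
          simp only: identity_expressions_graded_product)
        (elim disjE; simp add: graded_conditions_def zero_prod_def)
    then show "\<forall>x. ?E x = 0" ..
  next
    assume vanish: "\<forall>x. ?E x = 0"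
    \<comment> \<open>the coordinates \<open>s\<close> and \<open>t\<close> detect the two halves of the first condition\<close>
    have "?E ((\<lambda>_. (1, 0, 0, 0))(0 := (1, s, t, 0))) = 0" for s t
      using vanish by blast
    from this[of 0 0] this[of 1 0] this[of 0 1] show "graded_conditions \<alpha> ! i"
      using less_8_cases[OF assms] unfolding value_eq
      by (elim disjE;
          simp add: identity_expressions_graded_product graded_conditions_def zero_prod_def
            del: One_nat_def)
  qed
qed

text \<open>
  The sixth and seventh conditions couple the constants \<open>\<alpha> 1 2 0\<close>, \<open>\<alpha> 2 1 0\<close>, \<open>\<alpha> 2 1 1\<close> and
  \<open>\<alpha> 2 1 2\<close>, whence the entries 2 and 3: dropping one condition leaves a solution that
  violates it as long as the characteristic is not 3. In the first row the asymmetry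
  \<open>\<alpha> 2 1 0 \<noteq> \<alpha> 2 1 2\<close> has to be compensated by both.
\<close>

definition structure_constants :: "nat \<Rightarrow> nat \<Rightarrow> nat \<Rightarrow> nat \<Rightarrow> 'f::field" where
  "structure_constants i = (
    let \<alpha> = [
      [((1, 2, 0), 1), ((2, 1, 1), 2), ((2, 1, 2), 3)],
      [((1, 2, 1), 1)],
      [((1, 2, 2), 1)],
      [((2, 2, 0), 1), ((2, 2, 2), 1)],
      [((1, 1, 2), 1), ((1, 2, 2), 1)],
      [((1, 2, 0), 1), ((2, 1, 1), 2)],
      [((2, 1, 0), 1), ((2, 1, 2), 1), ((2, 2, 0), 1), ((2, 2, 2), 1), ((2, 1, 1), 2)],
      [((2, 2, 1), 1)]] ! i
    in (\<lambda>k l m. case map_of \<alpha> (k, l, m) of None \<Rightarrow> 0 | Some t \<Rightarrow> t))"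

lemma graded_conditions_structure_constants:
  assumes "i < 8" "j < 8"
  shows "graded_conditions (structure_constants i :: _ \<Rightarrow> _ \<Rightarrow> _ \<Rightarrow> 'f::field_char_0) ! j \<longleftrightarrow> j \<noteq> i"
  using less_8_cases[OF assms(1)] less_8_cases[OF assms(2)]
  by (elim disjE; simp add: graded_conditions_def structure_constants_def Let_def)

lemma T_ideal_omitting_one_identity:
  assumes "i < 8"
  obtains J :: "'f::field_char_0 tri_poly set"
  where "T_ideal J" "\<And>j. j < 8 \<Longrightarrow> identity_list ! j \<in> J \<longleftrightarrow> j \<noteq> i"
proof -
  let ?\<alpha> = "structure_constants i :: _ \<Rightarrow> _ \<Rightarrow> _ \<Rightarrow> 'f"
  interpret M: trilinear_algebra quadruple_scale "graded_product ?\<alpha> 1" "graded_product ?\<alpha> 2"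
    by (rule trilinear_algebra_graded_product)
  show ?thesis
    by (rule that[OF M.T_ideal_identities_of_algebra])
      (simp only: mem_Collect_eq graded_identity_iff graded_conditions_structure_constants assms)
qed

lemma card_jordan_triple_identities:
  "card (jordan_triple_identities :: 'f::field_char_0 tri_poly set) = 8"
proof -
  have "distinct (identity_list :: 'f tri_poly list)"
    unfolding distinct_conv_nth
    by (metis T_ideal_omitting_one_identity length_identity_list)
  then show ?thesis
    by (simp add: jordan_triple_identities_eq_set distinct_card)
qed

lemma independent_jordan_triple_identities:
  "independent_identities (jordan_triple_identities :: 'f::field_char_0 tri_poly set)"
  unfolding independent_identities_def
proof (intro ballI notI)
  fix p :: "'f tri_poly"
  assume "p \<in> jordan_triple_identities" and cons: "consequence (jordan_triple_identities - {p}) p"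
  then obtain i where i: "i < 8" and p: "p = identity_list ! i"
    by (auto simp: jordan_triple_identities_eq_set in_set_conv_nth)
  obtain J :: "'f tri_poly set"
    where J: "T_ideal J" "\<And>j. j < 8 \<Longrightarrow> identity_list ! j \<in> J \<longleftrightarrow> j \<noteq> i"
    using T_ideal_omitting_one_identity[OF i] by blast
  have "jordan_triple_identities - {p} \<subseteq> J"
    using J(2) by (force simp: jordan_triple_identities_eq_set in_set_conv_nth p)
  then have "T_ideal hull (jordan_triple_identities - {p}) \<subseteq> J"
    using J(1) by (rule hull_minimal)
  then show False
    using cons J(2)[OF i] by (auto simp: consequence_def p)
qed

section \<open>Functionals that vanish on the consequences of the identities\<close>

lemma vector_space_field: "vector_space ((*) :: 'f::field \<Rightarrow> 'f \<Rightarrow> 'f)"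
  by unfold_locales (simp_all add: algebra_simps)

text \<open>
  Extend a basis of the subspace by the given vector and prescribe the values on it.
\<close>

lemma (in vector_space) separating_functional:
  assumes "subspace I" "p \<notin> I"
  obtains \<phi> where "Vector_Spaces.linear scale (*) \<phi>" "\<And>q. q \<in> I \<Longrightarrow> \<phi> q = 0" "\<phi> p = 1"
proof -
  interpret field: vector_space "(*) :: 'a \<Rightarrow> 'a \<Rightarrow> 'a"
    by (rule vector_space_field)
  interpret vector_space_pair scale "(*) :: 'a \<Rightarrow> 'a \<Rightarrow> 'a" ..
  obtain B where B: "B \<subseteq> I" "independent B" "I \<subseteq> span B"
    by (rule maximal_independent_subset)
  have span_B: "span B = I"
    using B assms(1) by (metis span_minimal subset_antisym)
  then have "independent (insert p B)"
    using B(2) assms(2) by (simp add: independent_insertI)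
  then obtain \<phi> where lin: "Vector_Spaces.linear scale (*) \<phi>"
    and \<phi>: "\<And>x. x \<in> insert p B \<Longrightarrow> \<phi> x = (if x = p then 1 else 0)"
    using linear_independent_extend[of "insert p B" "\<lambda>x. if x = p then 1 else 0"] by blast
  have "\<phi> q = 0" if "q \<in> I" for q
  proof (rule linear_eq_0_on_span[OF lin])
    show "q \<in> span B" using that span_B by simp
    show "\<phi> x = 0" if "x \<in> B" for x
      using \<phi>[of x] that B(1) assms(2) by auto
  qed
  then show thesis
    using that lin \<phi>[of p] by simp
qed

locale vanishing_functional =
  fixes I :: "'f::field_char_0 tri_poly set" and \<phi> :: "'f tri_poly \<Rightarrow> 'f"
  assumes T_ideal_I: "T_ideal I" and identities_in_I: "jordan_triple_identities \<subseteq> I"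
    and linear_\<phi>: "Vector_Spaces.linear tscale (*) \<phi>"
    and \<phi>_vanishes: "p \<in> I \<Longrightarrow> \<phi> p = 0"
begin

sublocale \<phi>: Vector_Spaces.linear tscale "(*)" \<phi>
  by (rule linear_\<phi>)

lemma identity_instances:
  "list_all (\<lambda>p. p \<in> I) (identity_expressions op1 op2 a b c d e)"
proof -
  let ?\<sigma> = "(\<lambda>_. e)(0 := a, 1 := b, 2 := c, 3 := d)"
  have "substitute ?\<sigma> p \<in> I" if "p \<in> set identity_list" for p
    using that identities_in_I T_ideal_I
    by (auto simp: jordan_triple_identities_eq_set T_ideal_def)
  moreover have "map (substitute ?\<sigma>) identity_list = identity_expressions op1 op2 a b c d e"
    unfolding substitute_def free.map_value_at_identity_list by simp
  ultimately show ?thesis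
    unfolding list_all_iff by (metis (no_types, lifting) imageE list.set_map)
qed

lemmas op_diff = free.trilinear_diff[OF free.trilinear_f] free.trilinear_diff[OF free.trilinear_g]

lemma op2_flip: "\<phi> (op2 a b c) = \<phi> (op2 c b a)"
  using identity_instances[of a b c] \<phi>_vanishes[of "op2 a b c - op2 c b a"]
  by (simp add: identity_expressions_def \<phi>.diff)

text \<open>
  The difference in the first identity stays in the T-ideal when a further product is applied.
\<close>

lemma op2_flip_inside:
  "\<phi> (op1 (op2 a b c) d e) = \<phi> (op1 (op2 c b a) d e)"
  "\<phi> (op1 d (op2 a b c) e) = \<phi> (op1 d (op2 c b a) e)"
  "\<phi> (op1 d e (op2 a b c)) = \<phi> (op1 d e (op2 c b a))"
  "\<phi> (op2 (op2 a b c) d e) = \<phi> (op2 (op2 c b a) d e)"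
  "\<phi> (op2 d (op2 a b c) e) = \<phi> (op2 d (op2 c b a) e)"
proof -
  have "op2 a b c - op2 c b a \<in> I"
    using identity_instances[of a b c] by (simp add: identity_expressions_def)
  then have "op1 (op2 a b c - op2 c b a) d e \<in> I" "op1 d (op2 a b c - op2 c b a) e \<in> I"
    "op1 d e (op2 a b c - op2 c b a) \<in> I" "op2 (op2 a b c - op2 c b a) d e \<in> I"
    "op2 d (op2 a b c - op2 c b a) e \<in> I"
    using T_ideal_I by (auto simp: T_ideal_def)
  from this[THEN \<phi>_vanishes] show
    "\<phi> (op1 (op2 a b c) d e) = \<phi> (op1 (op2 c b a) d e)"
    "\<phi> (op1 d (op2 a b c) e) = \<phi> (op1 d (op2 c b a) e)"
    "\<phi> (op1 d e (op2 a b c)) = \<phi> (op1 d e (op2 c b a))"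
    "\<phi> (op2 (op2 a b c) d e) = \<phi> (op2 (op2 c b a) d e)"
    "\<phi> (op2 d (op2 a b c) e) = \<phi> (op2 d (op2 c b a) e)"
    by (simp_all add: op_diff \<phi>.diff)
qed

text \<open>
  The edges that remain after the first four identities. Each is written from the viewpoint of one
  of its end points: \<open>a\<close> is the distinguished letter, and \<open>p, q, r, s\<close> are the other letters of that
  word in this order. For \<open>L\<close>, \<open>M\<close>, \<open>R\<close> the word is \<open>a p q r s\<close>, and the other end point of \<open>L\<close> is
  \<open>q p a r s\<close> with \<open>a\<close> in the middle; \<open>N\<close> joins the middle-pointed words \<open>q p a r s\<close> and \<open>q r a p s\<close>.
  For \<open>P\<close>, \<open>Q\<close>, \<open>Z\<close> the word is \<open>p a q r s\<close>.
\<close>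

definition "L a p q r s = \<phi> (op1 (op1 a p q) r s)"
definition "M a p q r s = \<phi> (op1 a (op1 p q r) s)"
definition "R a p q r s = \<phi> (op1 a p (op1 q r s))"
definition "N a p q r s = \<phi> (op2 q (op2 p a r) s)"
definition "P a p q r s = \<phi> (op1 (op2 p a q) r s)"
definition "Q a p q r s = \<phi> (op2 (op1 s r q) a p)"
definition "Z a p q r s = \<phi> (op2 p (op1 a q r) s)"

text \<open>
  The last four equations are the alternating sums along four-cycles: the fourth and the seventh
  for an odd position of the distinguished letter, the other two for an even one.
\<close>

lemma identity_relations:
  "\<phi> (op1 a (op2 b c d) e) = M a b c d e"
  "\<phi> (op1 a b (op2 c d e)) = R a b c d e"
  "\<phi> (op2 (op2 a b c) d e) = Q d e c b a"
  "L e d c b a = L e b a d c - M e d a b c + R e d c b a"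
  "P d e c b a = Q d c a b e - Z d e a b c + Q d e a b c"
  "Q b a c d e = P b e a d c - Z b e a d c + P b c a d e"
  "N c b a d e = L c b a d e + L c d a b e - M c b a d e"
proof -
  have *: "\<phi> (op2 e d (op1 c b a)) = \<phi> (op2 (op1 c b a) d e)"
    by (rule op2_flip)
  have "list_all (\<lambda>p. \<phi> p = 0) (identity_expressions op1 op2 a b c d e)"
    using identity_instances \<phi>_vanishes unfolding list_all_iff by blast
  then show
    "\<phi> (op1 a (op2 b c d) e) = M a b c d e"
    "\<phi> (op1 a b (op2 c d e)) = R a b c d e"
    "\<phi> (op2 (op2 a b c) d e) = Q d e c b a"
    "L e d c b a = L e b a d c - M e d a b c + R e d c b a"
    "P d e c b a = Q d c a b e - Z d e a b c + Q d e a b c"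
    "Q b a c d e = P b e a d c - Z b e a d c + P b c a d e"
    "N c b a d e = L c b a d e + L c d a b e - M c b a d e"
    by (simp_all add: identity_expressions_def \<phi>.diff \<phi>.add
        L_def M_def R_def N_def P_def Q_def Z_def *)
qed

text \<open>
  Each edge, apart from \<open>L\<close>, can be read from either end: \<open>M\<close> and \<open>R\<close> exchange letters 1 and 3, or 2 and
  4, and \<open>P\<close>, \<open>Q\<close>, \<open>Z\<close> exchange two of the letters 1, 2 and 4 of the word. Both flips of
  \<open>N\<close> exchange its end points, the second one by writing them backwards.
\<close>

lemma flips:
  "M a p q r s = M a r q p s"
  "R a p q r s = R a p s r q"
  "N a p q r s = N a r q p s"
  "N a p q r s = N a p s r q"
  "P a p q r s = P a q p r s"
  "Q a p q r s = Q a p s r q"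
  "Z a p q r s = Z a s q r p"
  using op2_flip_inside op2_flip
  by (metis identity_relations(1), metis identity_relations(2), metis N_def, metis N_def,
      metis P_def, metis identity_relations(3), metis Z_def)

text \<open>
  For an edge weight \<open>x\<close> of the complete bipartite graph on three plus three vertices, let \<open>s\<close> and \<open>s'\<close>
  be the sums over the stars of its end points and \<open>t\<close> the sum over all edges. Adding up the
  vanishing alternating sums \<open>x\<^bsub>ij\<^esub> - x\<^bsub>ij'\<^esub> - x\<^bsub>i'j\<^esub> + x\<^bsub>i'j'\<^esub>\<close> over all \<open>i'\<close> and \<open>j'\<close> gives the
  premise; the conclusion exhibits the weight as a sum of two vertex potentials.
\<close>

lemma bipartite_average:
  fixes x :: "'a::field_char_0"
  assumes "9 * x = 3 * (s + s') - t"
  shows "x = (s / 3 - t / 18) + (s' / 3 - t / 18)"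
proof -
  have "(s / 3 - t / 18) + (s' / 3 - t / 18) = (3 * (s + s') - t) / 9"
    by (simp add: field_simps)
  also have "\<dots> = x"
    by (metis assms nonzero_mult_div_cancel_left zero_neq_numeral)
  finally show ?thesis ..
qed

text \<open>
  The nine edges of the component of \<open>a p q r s\<close> with distinguished letter \<open>a\<close>. One class of the
  bipartition consists of the words \<open>p q r s\<close> and \<open>r s p q\<close> after \<open>a\<close>, and of the middle-pointed word
  attached by \<open>L\<close> to \<open>r q p s\<close>; the other consists of \<open>r q p s\<close> and \<open>p s r q\<close> after \<open>a\<close>, and of
  the middle-pointed word attached by \<open>L\<close> to \<open>p q r s\<close>.
\<close>

definition "odd_total a p q r s =
  L a p q r s + L a r s p q + L a r q p s + L a p s r q +
  M a p q r s + M a r s p q + R a p q r s + R a r s p q + N a p q r s"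

definition "end_potential a p q r s =
  (L a p q r s + M a p q r s + R a p q r s) / 3 - odd_total a p q r s / 18"

definition "middle_potential a p q r s =
  (L a p q r s + L a r s p q + N a p q r s) / 3 - odd_total a p q r s / 18"

lemma odd_total_flip:
  "odd_total a r q p s = odd_total a p q r s"
  "odd_total a p s r q = odd_total a p q r s"
  by (simp_all add: odd_total_def flips add_ac)

lemma odd_edge_potentials:
  "L a p q r s = end_potential a p q r s + middle_potential a p q r s"
  "M a p q r s = end_potential a p q r s + end_potential a r q p s"
  "R a p q r s = end_potential a p q r s + end_potential a p s r q"
  "N a p q r s = middle_potential a p q r s + middle_potential a r q p s"
proof -
  have f: "M a r q p s = M a p q r s" "M a p s r q = M a r s p q"
    "R a r q p s = R a r s p q" "R a p s r q = R a p q r s"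
    "N a r q p s = N a p q r s"
    by (rule flips)+
  have f': "N a r s p q = N a p q r s"
    using flips(3)[of a r s p q] flips(4)[of a p q r s] by simp
  have L: "L a p q r s = L a r s p q - M a p s r q + R a p q r s" for p q r s
    by (rule identity_relations)
  have N: "N a p q r s = L a p q r s + L a r q p s - M a p q r s" for p q r s
    by (rule identity_relations)
  note rel = L[of p q r s, unfolded f] L[of r s p q, unfolded f] L[of p s r q, unfolded f]
    N[of p q r s, unfolded f]
  \<comment> \<open>the cycle space has dimension four, so five of the nine edges determine the others\<close>
  have M2: "M a r s p q = R a p q r s + R a r s p q - M a p q r s"
    using rel(1,2) by algebra
  have L2: "L a r s p q = L a p q r s + R a r s p q - M a p q r s"
    using rel(2) by algebra
  have L3: "L a r q p s = N a p q r s - L a p q r s + M a p q r s"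
    using rel(4) by algebra
  have L4: "L a p s r q = N a p q r s - L a p q r s + R a p q r s"
    using rel(3,4) by algebra
  have t: "odd_total a r q p s = odd_total a p q r s" "odd_total a p s r q = odd_total a p q r s"
    by (rule odd_total_flip)+
  show "L a p q r s = end_potential a p q r s + middle_potential a p q r s"
    and "M a p q r s = end_potential a p q r s + end_potential a r q p s"
    and "R a p q r s = end_potential a p q r s + end_potential a p s r q"
    and "N a p q r s = middle_potential a p q r s + middle_potential a r q p s"
    unfolding end_potential_def middle_potential_def t
    by (rule bipartite_average, simp only: odd_total_def f f' M2 L2 L3 L4, algebra)+
qed

text \<open>
  The component of \<open>p a q r s\<close> with distinguished letter \<open>a\<close>: the letter \<open>r\<close> is fixed, and the six
  arrangements of \<open>p, q, s\<close> are the vertices. The two classes are the even and the odd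
  arrangements, since every edge is a transposition.
\<close>

definition "even_total a p q r s =
  P a p q r s + P a q s r p + P a s p r q +
  Q a p q r s + Q a q s r p + Q a s p r q +
  Z a p q r s + Z a q s r p + Z a s p r q"

definition "even_potential a p q r s =
  (P a p q r s + Q a p q r s + Z a p q r s) / 3 - even_total a p q r s / 18"

lemma even_total_flip:
  "even_total a q p r s = even_total a p q r s"
  "even_total a p s r q = even_total a p q r s"
  "even_total a s q r p = even_total a p q r s"
  by (simp_all add: even_total_def flips add_ac)

lemma even_edge_potentials:
  "P a p q r s = even_potential a p q r s + even_potential a q p r s"
  "Q a p q r s = even_potential a p q r s + even_potential a p s r q"
  "Z a p q r s = even_potential a p q r s + even_potential a s q r p"
proof -
  have f: "P a q p r s = P a p q r s" "P a p s r q = P a s p r q" "P a s q r p = P a q s r p"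
    "Q a q p r s = Q a q s r p" "Q a p s r q = Q a p q r s" "Q a s q r p = Q a s p r q"
    "Z a q p r s = Z a s p r q" "Z a p s r q = Z a q s r p" "Z a s q r p = Z a p q r s"
    by (rule flips)+
  have P: "P a p q r s = Q a q s r p - Z a p s r q + Q a p s r q" for p q r s
    by (rule identity_relations)
  have Q: "Q a p q r s = P a s p r q - Z a s p r q + P a q p r s" for p q r s
    by (rule identity_relations)
  note P1 = P[of p q r s, unfolded f] and P2 = P[of q s r p, unfolded f]
    and P3 = P[of s p r q, unfolded f]
  \<comment> \<open>as before, five edges determine the other four, namely those of type \<open>P\<close> and one of type \<open>Z\<close>\<close>
  have Z3: "Z a s p r q = Q a p q r s + Q a q s r p + Q a s p r q - Z a p q r s - Z a q s r p"
    using P1 P3 Q[of p q r s, unfolded f] by algebra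
  have t: "even_total a q p r s = even_total a p q r s" "even_total a p s r q = even_total a p q r s"
    "even_total a s q r p = even_total a p q r s"
    by (rule even_total_flip)+
  show "P a p q r s = even_potential a p q r s + even_potential a q p r s"
    and "Q a p q r s = even_potential a p q r s + even_potential a p s r q"
    and "Z a p q r s = even_potential a p q r s + even_potential a s q r p"
    unfolding even_potential_def t
    by (rule bipartite_average, simp only: even_total_def f P1 P2 P3 Z3, algebra)+
qed

text \<open>
  A pointed word is given by the letters before the distinguished one, that letter, and the
  letters after it. A monomial evaluates to words together with their reversals, so the
  potential of a class is placed on the representative with the distinguished letter in the first
  half, and divided evenly between the two words if this letter is in the middle.
\<close>

fun potential :: "nat list \<times> nat \<times> nat list \<Rightarrow> 'f" where
  "potential ([], a, []) = \<phi> (var a)"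
| "potential ([], a, [p, q]) = \<phi> (op1 (var a) (var p) (var q))"
| "potential ([p], a, [q]) = \<phi> (op2 (var p) (var a) (var q)) / 2"
| "potential ([], a, [p, q, r, s]) = end_potential (var a) (var p) (var q) (var r) (var s)"
| "potential ([p], a, [q, r, s]) = even_potential (var a) (var p) (var q) (var r) (var s)"
| "potential ([q, p], a, [r, s]) = middle_potential (var a) (var p) (var q) (var r) (var s) / 2"
| "potential _ = 0"

end

section \<open>The dialgebra of words with a distinguished letter\<close>

type_synonym pointed_word = "nat list \<times> nat \<times> nat list"

fun word_left :: "pointed_word \<Rightarrow> pointed_word \<Rightarrow> pointed_word" where
  "word_left (l, a, r) (l', a', r') = (l, a, r @ l' @ a' # r')"

fun word_right :: "pointed_word \<Rightarrow> pointed_word \<Rightarrow> pointed_word" where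
  "word_right (l, a, r) (l', a', r') = (l @ a # r @ l', a', r')"

text \<open>
  Pointed words are countably many, so they can be coded as the basis of the vector space
  \<^typ>\<open>nat \<Rightarrow>\<^sub>0 'f\<close>. A number that codes no word in the sense of \<^const>\<open>to_nat\<close> still decodes
  to one under \<^const>\<open>from_nat\<close>, and this suffices for associativity.
\<close>

definition word :: "pointed_word \<Rightarrow> nat \<Rightarrow>\<^sub>0 'f::field" where
  "word w = Poly_Mapping.single (to_nat w) 1"

definition word_product ::
    "(pointed_word \<Rightarrow> pointed_word \<Rightarrow> pointed_word)
     \<Rightarrow> (nat \<Rightarrow>\<^sub>0 'f::field) \<Rightarrow> (nat \<Rightarrow>\<^sub>0 'f) \<Rightarrow> (nat \<Rightarrow>\<^sub>0 'f)" where
  "word_product h p q =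
    linear_extension coeff_scale (\<lambda>i. linear_extension coeff_scale
      (\<lambda>j. word (h (from_nat i) (from_nat j))) q) p"

lemma word_product_linear:
  "Vector_Spaces.linear coeff_scale coeff_scale (\<lambda>p. word_product h p q :: nat \<Rightarrow>\<^sub>0 'f::field)"
  "Vector_Spaces.linear coeff_scale coeff_scale (\<lambda>q. word_product h p q :: nat \<Rightarrow>\<^sub>0 'f::field)"
proof -
  interpret vector_space "coeff_scale :: 'f \<Rightarrow> (nat \<Rightarrow>\<^sub>0 'f) \<Rightarrow> _"
    by (rule vector_space_coeff_scale)
  show
    "Vector_Spaces.linear coeff_scale coeff_scale (\<lambda>p. word_product h p q :: nat \<Rightarrow>\<^sub>0 'f::field)"
    "Vector_Spaces.linear coeff_scale coeff_scale (\<lambda>q. word_product h p q :: nat \<Rightarrow>\<^sub>0 'f::field)"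
    unfolding Vector_Spaces.linear_iff word_product_def
    by (auto simp: vector_space_axioms linear_extension_add
        linear_extension_coeff_scale linear_extension_of_add linear_extension_of_scale)
qed

lemma word_product_add:
  "word_product h (p + p') q = word_product h p q + word_product h p' q"
  "word_product h p (q + q') = word_product h p q + word_product h p q'"
  using word_product_linear(1)[of h q] word_product_linear(2)[of h p]
  by (simp_all add: Vector_Spaces.linear_iff)

lemma word_product_single:
  "word_product h (Poly_Mapping.single i c) (Poly_Mapping.single j d) =
    Poly_Mapping.single (to_nat (h (from_nat i) (from_nat j))) (c * d :: 'f::field)"
proof -
  interpret vector_space "coeff_scale :: 'f \<Rightarrow> (nat \<Rightarrow>\<^sub>0 'f) \<Rightarrow> _"
    by (rule vector_space_coeff_scale)
  show ?thesis
    by (simp add: word_product_def word_def)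
qed

lemma word_product_word:
  "word_product h (word u) (word v) = (word (h u v) :: nat \<Rightarrow>\<^sub>0 'f::field)"
  by (simp add: word_def word_product_single)

text \<open>
  All five dialgebra laws compare two ways of multiplying three basis elements; this lemma
  transfers such a comparison to the whole space.
\<close>

lemma word_product_triple_left:
  assumes "\<And>u v w. h (k u v) w = h' u (k' v w)"
  shows "word_product h (word_product k x y) z =
    word_product h' x (word_product k' y z :: nat \<Rightarrow>\<^sub>0 'f::field)"
proof (induction x rule: poly_mapping_induct_single_add)
  case (single i c)
  show ?case
  proof (induction y rule: poly_mapping_induct_single_add)
    case (single j d)
    show ?case
      by (induction z rule: poly_mapping_induct_single_add)
        (simp_all add: word_product_single word_product_add assms mult.assoc)
  qed (simp_all add: word_product_add)
qed (simp_all add: word_product_add)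

lemma associative_dialgebra_words:
  "associative_dialgebra (coeff_scale :: 'f::field \<Rightarrow> (nat \<Rightarrow>\<^sub>0 'f) \<Rightarrow> _)
    (word_product word_left) (word_product word_right)"
proof -
  have assoc: "word_left (word_left u v) w = word_left u (word_left v w)"
    "word_left (word_left u v) w = word_left u (word_right v w)"
    "word_right (word_left u v) w = word_right u (word_right v w)"
    "word_right (word_right u v) w = word_right u (word_right v w)"
    "word_left (word_right u v) w = word_right u (word_left v w)" for u v w
    by (cases u; cases v; cases w; simp)+
  show ?thesis
  proof (intro associative_dialgebra.intro associative_dialgebra_axioms.intro
      vector_space_coeff_scale word_product_linear)
    fix x y z :: "nat \<Rightarrow>\<^sub>0 'f"
    let ?l = "word_product word_left" and ?r = "word_product word_right"
    have laws: "?l (?l x y) z = ?l x (?l y z)" "?l (?l x y) z = ?l x (?r y z)"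
      "?r (?l x y) z = ?r x (?r y z)" "?r (?r x y) z = ?r x (?r y z)"
      "?l (?r x y) z = ?r x (?l y z)"
      by (rule word_product_triple_left, rule assoc)+
    then show "?l (?l x y) z = ?l x (?l y z)" "?r (?r x y) z = ?r x (?r y z)"
      "?l (?r x y) z = ?r x (?l y z)"
      by simp_all
    show "?l x (?l y z) = ?l x (?r y z)" "?r (?l x y) z = ?r (?r x y) z"
      by (rule trans[OF laws(1)[symmetric] laws(2)], rule trans[OF laws(3) laws(4)[symmetric]])
  qed
qed

section \<open>Identities of degree at most five\<close>

lemma length_leaves_pos: "length (leaves m) > 0"
  by (induction m) auto

lemma odd_length_leaves: "odd (length (leaves m))"
  by (induction m) auto

lemma length_leaves_1:
  assumes "length (leaves m) = 1"
  obtains a where "m = Var a"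
proof (cases m)
  case (Tri1 s t u)
  then show ?thesis
    using assms length_leaves_pos[of s] length_leaves_pos[of t] length_leaves_pos[of u] by simp
next
  case (Tri2 s t u)
  then show ?thesis
    using assms length_leaves_pos[of s] length_leaves_pos[of t] length_leaves_pos[of u] by simp
qed

lemma sum_of_three_odds:
  assumes "odd i" "odd j" "odd k" "i + j + k \<le> (5::nat)"
  shows "i = 1 \<and> j = 1 \<and> k = 1 \<or> i = 3 \<and> j = 1 \<and> k = 1 \<or> i = 1 \<and> j = 3 \<and> k = 1 \<or> i = 1 \<and> j = 1 \<and> k = 3"
proof -
  obtain i' j' k' where "i = 2 * i' + 1" "j = 2 * j' + 1" "k = 2 * k' + 1"
    using assms by (auto elim!: oddE)
  then show ?thesis
    using assms(4) by simp linarith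
qed

lemma not_Var_cases:
  obtains a where "m = Var a"
  | F s t u where "F \<in> {Tri1, Tri2}" "m = F s t u"
      "length (leaves m) = length (leaves s) + length (leaves t) + length (leaves u)"
proof (cases m)
  case (Var a)
  then show ?thesis by (rule that(1))
next
  case (Tri1 s t u)
  then show ?thesis using that(2)[of Tri1 s t u] by simp
next
  case (Tri2 s t u)
  then show ?thesis using that(2)[of Tri2 s t u] by simp
qed

lemma length_leaves_3:
  assumes "length (leaves m) = 3"
  obtains F a b c where "F \<in> {Tri1, Tri2}" "m = F (Var a) (Var b) (Var c)"
proof (cases m rule: not_Var_cases)
  case (2 F s t u)
  then have "length (leaves s) = 1" "length (leaves t) = 1" "length (leaves u) = 1"
    using assms length_leaves_pos[of s] length_leaves_pos[of t] length_leaves_pos[of u] by linarith+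
  then obtain a b c where "s = Var a" "t = Var b" "u = Var c"
    by (metis length_leaves_1)
  then show ?thesis
    using 2(1,2) that[of F a b c] by simp
qed (use assms in simp)

lemma degree_le_5_cases:
  assumes "length (leaves m) \<le> 5"
  obtains a where "m = Var a"
  | F a b c where "F \<in> {Tri1, Tri2}" "m = F (Var a) (Var b) (Var c)"
  | F G a b c d e where "F \<in> {Tri1, Tri2}" "G \<in> {Tri1, Tri2}"
      "m = F (G (Var a) (Var b) (Var c)) (Var d) (Var e)"
  | F G a b c d e where "F \<in> {Tri1, Tri2}" "G \<in> {Tri1, Tri2}"
      "m = F (Var a) (G (Var b) (Var c) (Var d)) (Var e)"
  | F G a b c d e where "F \<in> {Tri1, Tri2}" "G \<in> {Tri1, Tri2}"
      "m = F (Var a) (Var b) (G (Var c) (Var d) (Var e))"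
proof (cases m rule: not_Var_cases)
  case 1
  then show ?thesis by (rule that(1))
next
  case (2 F s t u)
  from 2(3) assms sum_of_three_odds[OF odd_length_leaves odd_length_leaves odd_length_leaves, of s t u]
  consider "length (leaves s) = 1" "length (leaves t) = 1" "length (leaves u) = 1"
    | "length (leaves s) = 3" "length (leaves t) = 1" "length (leaves u) = 1"
    | "length (leaves s) = 1" "length (leaves t) = 3" "length (leaves u) = 1"
    | "length (leaves s) = 1" "length (leaves t) = 1" "length (leaves u) = 3"
    by auto
  then show ?thesis
  proof cases
    case 1
    then obtain a b c where "s = Var a" "t = Var b" "u = Var c"
      by (metis length_leaves_1)
    then show ?thesis
      using 2(1,2) that(2)[of F a b c] by simp
  next
    case l: 2
    obtain d e where "t = Var d" "u = Var e"
      using l(2,3) by (metis length_leaves_1)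
    moreover obtain G a b c where "G \<in> {Tri1, Tri2}" "s = G (Var a) (Var b) (Var c)"
      using l(1) by (rule length_leaves_3)
    ultimately show ?thesis
      using 2(1,2) that(3)[of F G a b c d e] by simp
  next
    case l: 3
    obtain d e where "s = Var d" "u = Var e"
      using l(1,3) by (metis length_leaves_1)
    moreover obtain G a b c where "G \<in> {Tri1, Tri2}" "t = G (Var a) (Var b) (Var c)"
      using l(2) by (rule length_leaves_3)
    ultimately show ?thesis
      using 2(1,2) that(4)[of F G d a b c e] by simp
  next
    case l: 4
    obtain d e where "s = Var d" "t = Var e"
      using l(1,2) by (metis length_leaves_1)
    moreover obtain G a b c where "G \<in> {Tri1, Tri2}" "u = G (Var a) (Var b) (Var c)"
      using l(3) by (rule length_leaves_3)
    ultimately show ?thesis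
      using 2(1,2) that(5)[of F G d e a b c] by simp
  qed
qed

lemma single_eq_op:
  "Poly_Mapping.single (Tri1 s t u) (1 :: 'f::field) =
    op1 (Poly_Mapping.single s 1) (Poly_Mapping.single t 1) (Poly_Mapping.single u 1)"
  "Poly_Mapping.single (Tri2 s t u) (1 :: 'f::field) =
    op2 (Poly_Mapping.single s 1) (Poly_Mapping.single t 1) (Poly_Mapping.single u 1)"
  by (simp_all add: op1_def op2_def trilinear_extension_def)

abbreviation (input) "word_diproduct1 \<equiv>
  associative_dialgebra.diproduct1 (word_product word_left) (word_product word_right)"
abbreviation (input) "word_diproduct2 \<equiv>
  associative_dialgebra.diproduct2 (word_product word_left) (word_product word_right)"

context vanishing_functional
begin

definition "potential_sum = linear_extension (*) (\<lambda>n. potential (from_nat n))"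

lemma linear_potential_sum: "Vector_Spaces.linear coeff_scale (*) potential_sum"
  unfolding potential_sum_def
  by (rule vector_space.linear_linear_extension[OF vector_space_field])

lemma potential_sum_word: "potential_sum (word w) = potential w"
  by (simp add: potential_sum_def word_def vector_space.linear_extension_single[OF vector_space_field])

lemma edge_of_monomial:
  "\<phi> (op1 (op1 a b c) d e) = L a b c d e"
  "\<phi> (op1 a (op1 b c d) e) = M a b c d e"
  "\<phi> (op1 a b (op1 c d e)) = R a b c d e"
  "\<phi> (op1 (op2 a b c) d e) = P b a c d e"
  "\<phi> (op2 (op1 a b c) d e) = Q d e c b a"
  "\<phi> (op2 a (op1 b c d) e) = Z b a c d e"
  "\<phi> (op2 a (op2 b c d) e) = N c b a d e"
  "\<phi> (op1 a (op2 b c d) e) = M a b c d e"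
  "\<phi> (op1 a b (op2 c d e)) = R a b c d e"
  "\<phi> (op2 (op2 a b c) d e) = Q d e c b a"
  "\<phi> (op2 a b (op1 c d e)) = Q b a e d c"
  "\<phi> (op2 a b (op2 c d e)) = Q b a e d c"
  by (simp_all only: L_def[symmetric] M_def[symmetric] R_def[symmetric] N_def[symmetric]
        P_def[symmetric] Q_def[symmetric] Z_def[symmetric] identity_relations(1-3),
      subst op2_flip, rule Q_def[symmetric], subst op2_flip, rule identity_relations)

lemma middle_potential_flip: "middle_potential a p q r s = middle_potential a r s p q"
proof -
  have "odd_total a p q r s = odd_total a r s p q" "N a p q r s = N a r s p q"
    by (rule trans[OF odd_total_flip(1)[symmetric] odd_total_flip(2)[symmetric]], rule trans[OF flips(3,4)])
  then show ?thesis
    by (simp add: middle_potential_def add_ac)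
qed

text \<open>
  The functional factors through evaluation at the single letters: a monomial is an edge, its value
  is the sum of its end points, and an edge has the sum of the potentials of its end points.
\<close>

lemma potential_sum_eval_monomial:
  assumes "length (leaves m) \<le> 5"
  shows "\<phi> (Poly_Mapping.single m 1) =
    potential_sum (eval_monomial word_diproduct1 word_diproduct2 (\<lambda>i. word ([], i, [])) m)"
proof -
  interpret W: associative_dialgebra "coeff_scale :: 'f \<Rightarrow> (nat \<Rightarrow>\<^sub>0 'f) \<Rightarrow> _"
    "word_product word_left" "word_product word_right"
    by (rule associative_dialgebra_words)
  interpret T: Vector_Spaces.linear coeff_scale "(*)" potential_sum
    by (rule linear_potential_sum)
  show ?thesis
    by (cases rule: degree_le_5_cases[OF assms])
      (auto simp: middle_potential_flip op2_flip[of "var a" "var b" "var c" for a b c]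
        single_eq_op edge_of_monomial odd_edge_potentials even_edge_potentials
        W.diproduct1_def W.diproduct2_def word_product_add word_product_word T.add potential_sum_word simp flip: var_def)
qed

end

text \<open>
  A functional that detected such a polynomial outside the T-ideal would factor through its value
  in the dialgebra of pointed words, which is zero.
\<close>

lemma identity_of_degree_le_5_in_T_ideal:
  fixes p :: "'f::field_char_0 tri_poly"
  assumes I: "T_ideal I" "jordan_triple_identities \<subseteq> I"
    and deg: "\<And>m. m \<in> Poly_Mapping.keys p \<Longrightarrow> length (leaves m) \<le> 5"
    and sat: "satisfied_in_dialgebras TYPE(nat \<Rightarrow>\<^sub>0 'f) p"
  shows "p \<in> I"
proof (rule ccontr)
  assume "p \<notin> I"
  have "module.subspace tscale I"
    using I(1) by (simp add: T_ideal_def)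
  then obtain \<phi> where lin: "Vector_Spaces.linear tscale (*) \<phi>"
    and "\<And>q. q \<in> I \<Longrightarrow> \<phi> q = 0" and \<phi>_p: "\<phi> p = 1"
    using vector_space.separating_functional[OF vector_space_tscale] \<open>p \<notin> I\<close> by metis
  then interpret vanishing_functional I \<phi>
    using I by (intro vanishing_functional.intro)
  interpret T: Vector_Spaces.linear coeff_scale "(*)" potential_sum
    by (rule linear_potential_sum)
  let ?v = "eval_monomial word_diproduct1 word_diproduct2 (\<lambda>i. word ([], i, []))"
  have expand: "(\<Sum>m\<in>Poly_Mapping.keys p. tscale (Poly_Mapping.lookup p m) (Poly_Mapping.single m 1)) = p"
    by (rule poly_mapping_eqI)
      (auto simp: tscale_eq_coeff_scale lookup_sum lookup_single when_def in_keys_iff)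
  have "\<phi> p = \<phi> (\<Sum>m\<in>Poly_Mapping.keys p. tscale (Poly_Mapping.lookup p m) (Poly_Mapping.single m 1))"
    by (simp only: expand)
  also have "\<dots> = (\<Sum>m\<in>Poly_Mapping.keys p. Poly_Mapping.lookup p m * \<phi> (Poly_Mapping.single m 1))"
    by (simp only: \<phi>.sum \<phi>.scale)
  also have "\<dots> = (\<Sum>m\<in>Poly_Mapping.keys p. Poly_Mapping.lookup p m * potential_sum (?v m))"
    using deg by (simp add: potential_sum_eval_monomial)
  also have "\<dots> = potential_sum (eval_tri_poly coeff_scale word_diproduct1 word_diproduct2
      (\<lambda>i. word ([], i, [])) p)"
    by (simp add: eval_tri_poly_def T.sum T.scale)
  also have "\<dots> = 0"
    using sat[unfolded satisfied_in_dialgebras_def, rule_format, OF associative_dialgebra_words]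
    by (simp only: T.zero)
  finally show False
    using \<phi>_p by simp
qed

theorem theorem5p8:
  shows "card (jordan_triple_identities :: 'f::field_char_0 tri_poly set) = 8 \<and>
    independent_identities (jordan_triple_identities :: 'f tri_poly set) \<and>
    (\<forall>p \<in> (jordan_triple_identities :: 'f tri_poly set).
       satisfied_in_dialgebras TYPE('v::ab_group_add) p) \<and>
    (\<forall>n \<le> 5. \<forall>p :: 'f tri_poly.
       multilinear_of_degree n p \<and> satisfied_in_dialgebras TYPE(nat \<Rightarrow>\<^sub>0 'f) p \<longrightarrow>
       consequence jordan_triple_identities p)"
proof (intro conjI allI impI ballI)
  show "card (jordan_triple_identities :: 'f tri_poly set) = 8"
    by (rule card_jordan_triple_identities)
  show "independent_identities (jordan_triple_identities :: 'f tri_poly set)"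
    by (rule independent_jordan_triple_identities)
  show "satisfied_in_dialgebras TYPE('v) p" if "p \<in> jordan_triple_identities" for p :: "'f tri_poly"
    using that by (rule identities_satisfied_in_dialgebras)
next
  fix n and p :: "'f tri_poly"
  assume n: "n \<le> 5"
    and p: "multilinear_of_degree n p \<and> satisfied_in_dialgebras TYPE(nat \<Rightarrow>\<^sub>0 'f) p"
  have "length (leaves m) \<le> 5" if "m \<in> Poly_Mapping.keys p" for m
    using that p n unfolding multilinear_of_degree_def by (metis distinct_card)
  then show "consequence jordan_triple_identities p"
    using p identity_of_degree_le_5_in_T_ideal unfolding consequence_def hull_def by blast
qed

end
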